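(* Let $a,b,c\in\mathbb{R}$ with $abc\neq 0$, and let $\{a_n\}_{n\ge 0}$ be a sequence of real numbers with $(a_0,a_1)\neq(0,0)$ satisfying $c\,a_{n+2}+b\,a_{n+1}+a\,a_n=0$ for all $n\ge 0$. For $m\ge 0$ let $P_m(z)=\sum_{n=0}^{m}a_nz^n$. Let $\alpha$ be a zero of largest modulus of the polynomial $at^2+bt+c$. Suppose $ac>0$, $b^2-4ac>0$, and $a_0b(a_1c+ba_0)\le 0$. Then for all sufficiently large $m$, all the zeros of $P_m(z)$ lie inside the closed ball centered at $0$ with radius $|c|/|a\alpha|$. *)

theory Defs
  imports "HOL-Analysis.Analysis" "HOL-Computational_Algebra.Polynomial"
begin

text \<open>The coefficients are real; the polynomial is taken over the complex numbers because its
  zeros are sought there.\<close>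

definition partial_sum_poly :: "(nat \<Rightarrow> real) \<Rightarrow> nat \<Rightarrow> complex poly" where
  "partial_sum_poly u m = (\<Sum>n\<le>m. monom (complex_of_real (u n)) n)"

end

theory Submission
  imports Defs
begin

text \<open>The roots of \<open>at\<^sup>2 + bt + c\<close> are real of equal sign. Let \<open>\<beta>\<close> be the root
  other than \<open>\<alpha>\<close>, so that the radius is \<open>\<bar>\<beta>\<bar>\<close>, and put \<open>r = \<beta>/\<alpha> > 0\<close>. The rescaled
  coefficients \<open>v\<^sub>n = u\<^sub>n \<beta>\<^sup>n\<close> satisfy \<open>v\<^sub>n\<^sub>+\<^sub>2 - v\<^sub>n\<^sub>+\<^sub>1 = r (v\<^sub>n\<^sub>+\<^sub>1 - v\<^sub>n)\<close>, hence
  are monotone, and the sign hypothesis amounts to \<open>v\<^sub>0 (v\<^sub>1 - v\<^sub>0 - r v\<^sub>0) \<ge> 0\<close>. So up to a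
  common sign they are nonnegative and increasing, and the Enestroem-Kakeya theorem applies.\<close>

text \<open>Summation by parts: multiplying by \<open>z - 1\<close> turns the inner coefficients
  into consecutive differences, whose signs monotonicity controls.\<close>

lemma enestrom_kakeya_identity:
  fixes w :: "nat \<Rightarrow> 'a::comm_ring_1"
  shows "(z - 1) * (\<Sum>n\<le>m. w n * z ^ n) =
    w m * z ^ Suc m - w 0 - (\<Sum>n<m. (w (Suc n) - w n) * z ^ Suc n)"
  by (induction m) (simp_all add: algebra_simps)

text \<open>If \<open>norm z > 1\<close>, the identity isolates \<open>w m * z ^ Suc m\<close>. The
  remaining coefficients, \<open>w 0\<close> and the differences, are nonnegative with total
  \<open>w m\<close>, and each power of \<open>norm z\<close> beside them is at most
  \<open>norm z ^ m\<close>. Hence \<open>norm z ^ Suc m \<le> norm z ^ m\<close>, which is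
  absurd.\<close>

lemma enestrom_kakeya:
  fixes w :: "nat \<Rightarrow> real" and z :: "'a::real_normed_field"
  assumes mono: "\<And>n. n < m \<Longrightarrow> w n \<le> w (Suc n)" and "0 \<le> w 0" and "0 < w m"
    and root: "(\<Sum>n\<le>m. of_real (w n) * z ^ n) = 0"
  shows "norm z \<le> 1"
proof (rule ccontr)
  assume "\<not> norm z \<le> 1"
  then have z: "1 < norm z" by simp
  have "w m * norm z ^ Suc m = norm (of_real (w m) * z ^ Suc m)"
    using \<open>0 < w m\<close> by (simp add: norm_mult norm_power)
  also have "of_real (w m) * z ^ Suc m =
      of_real (w 0) + (\<Sum>n<m. of_real (w (Suc n) - w n) * z ^ Suc n)"
    using enestrom_kakeya_identity[of z "\<lambda>n. of_real (w n)" m] root by (simp add: algebra_simps)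
  also have "norm \<dots> \<le> w 0 + (\<Sum>n<m. (w (Suc n) - w n) * norm z ^ Suc n)"
  proof (intro norm_triangle_le add_mono sum_norm_le)
    fix n assume "n \<in> {..<m}"
    then show "norm (of_real (w (Suc n) - w n) * z ^ Suc n) \<le> (w (Suc n) - w n) * norm z ^ Suc n"
      using mono[of n] by (simp add: norm_mult norm_power del: of_real_diff)
  qed (use \<open>0 \<le> w 0\<close> in simp)
  also have "\<dots> \<le> w 0 * norm z ^ m + (\<Sum>n<m. (w (Suc n) - w n) * norm z ^ m)"
  proof (intro add_mono sum_mono mult_left_mono power_increasing)
    show "w 0 \<le> w 0 * norm z ^ m"
      using z \<open>0 \<le> w 0\<close> by (simp add: mult_le_cancel_left1 one_le_power)
  qed (use z mono in auto)
  also have "\<dots> = w m * norm z ^ m"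
    by (simp add: sum_lessThan_telescope flip: sum_distrib_right distrib_right)
  finally have "norm z ^ Suc m \<le> norm z ^ m"
    using \<open>0 < w m\<close> by (simp only: mult_le_cancel_left_pos)
  then show False
    using z power_strict_increasing[of m "Suc m" "norm z"] by simp
qed

text \<open>Completing the square makes \<open>2 * a * z + b\<close> a square root of the positive
  discriminant, hence real. If \<open>a = 0\<close>, the discriminant forces
  \<open>b \<noteq> 0\<close> and the equation is linear.\<close>

lemma real_quadratic_root_of_discriminant_pos:
  fixes a b c :: real and z :: complex
  assumes "0 < b\<^sup>2 - 4 * a * c"
    and root: "of_real a * z\<^sup>2 + of_real b * z + of_real c = 0"
  shows "z \<in> \<real>"
proof -
  have "(of_real (2 * a) * z + of_real b)\<^sup>2 = (of_real (b\<^sup>2 - 4 * a * c) :: complex)"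
    using root by (simp add: power2_eq_square) (use root in \<open>algebra\<close>)
  also have "\<dots> = (of_real (sqrt (b\<^sup>2 - 4 * a * c)))\<^sup>2"
    using assms(1) by (simp flip: of_real_power)
  finally have "of_real (2 * a) * z + of_real b \<in> \<real>"
    by (auto simp: power2_eq_iff)
  show ?thesis
  proof (cases "a = 0")
    case True
    with assms show ?thesis
      by (auto simp: complex_is_Real_iff complex_eq_iff)
  next
    case False
    with \<open>_ \<in> \<real>\<close> show ?thesis
      by (auto simp: complex_is_Real_iff)
  qed
qed

theorem theorem2:
  fixes a b c :: real and u :: "nat \<Rightarrow> real" and \<alpha> :: complex
  assumes "a * b * c \<noteq> 0"
    and "(u 0, u 1) \<noteq> (0, 0)"
    and "\<And>n. c * u (n + 2) + b * u (n + 1) + a * u n = 0"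
    and "poly [:complex_of_real c, complex_of_real b, complex_of_real a:] \<alpha> = 0"
    and "\<And>t. poly [:complex_of_real c, complex_of_real b, complex_of_real a:] t = 0
           \<Longrightarrow> norm t \<le> norm \<alpha>"
    and "a * c > 0"
    and "b\<^sup>2 - 4 * a * c > 0"
    and "u 0 * b * (u 1 * c + b * u 0) \<le> 0"
  shows "\<forall>\<^sub>F m in sequentially. \<forall>z. poly (partial_sum_poly u m) z = 0
           \<longrightarrow> z \<in> cball 0 (\<bar>c\<bar> / norm (complex_of_real a * \<alpha>))"
proof -
  have "a \<noteq> 0" using \<open>a * b * c \<noteq> 0\<close> by auto
  have "\<alpha> \<in> \<real>"
    using assms(4,7)
    by (intro real_quadratic_root_of_discriminant_pos[of b a c])
      (auto simp: algebra_simps power2_eq_square)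
  then obtain x where \<alpha>: "\<alpha> = of_real x" by (auto elim: Reals_cases)
  \<comment> \<open>The second root, read off from the sum of the roots.\<close>
  define \<beta> where "\<beta> = - b / a - x"
  have "of_real (c + x * (b + x * a)) = (0 :: complex)"
    using assms(4) by (simp add: \<alpha>)
  then have root: "c + x * (b + x * a) = 0" by (simp only: of_real_eq_0_iff)
  have b: "b = - a * (x + \<beta>)"
    using \<open>a \<noteq> 0\<close> by (simp add: \<beta>_def)
  have c: "c = a * x * \<beta>"
    using root by (simp add: b algebra_simps)
  have "0 < a\<^sup>2 * (x * \<beta>)"
    using \<open>a * c > 0\<close> by (simp add: c power2_eq_square algebra_simps)
  then have "0 < x * \<beta>" using \<open>a \<noteq> 0\<close> by (simp add: zero_less_mult_iff)
  have "x \<noteq> 0" "\<beta> \<noteq> 0" using \<open>0 < x * \<beta>\<close> by auto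
  define r where "r = \<beta> / x"
  have \<beta>: "\<beta> = r * x" using \<open>x \<noteq> 0\<close> by (simp add: r_def)
  have "0 < r"
    using \<open>0 < x * \<beta>\<close> by (auto simp: r_def zero_less_mult_iff zero_less_divide_iff)
  define v where "v n = u n * \<beta> ^ n" for n
  \<comment> \<open>The characteristic roots of the recurrence for \<open>u\<close> are
    \<open>1 / x\<close> and \<open>1 / \<beta>\<close>. Scaling by \<open>\<beta> ^ n\<close> moves
    them to \<open>r\<close> and \<open>1\<close>, and taking differences removes the root
    \<open>1\<close>.\<close>
  have step: "v (Suc (Suc n)) - v (Suc n) = r * (v (Suc n) - v n)" for n
  proof -
    have "a * (x * \<beta> * u (n + 2) - (x + \<beta>) * u (n + 1) + u n) = 0"
      using assms(3)[of n] by (simp add: b c algebra_simps)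
    then have "x * \<beta> * u (n + 2) - (x + \<beta>) * u (n + 1) + u n = 0"
      using \<open>a \<noteq> 0\<close> by (metis mult_eq_0_iff)
    moreover have "v (Suc (Suc n)) - v (Suc n) - r * (v (Suc n) - v n)
        = r * \<beta> ^ n * (x * \<beta> * u (n + 2) - (x + \<beta>) * u (n + 1) + u n)"
      by (simp add: v_def \<beta> algebra_simps)
    ultimately show ?thesis by simp
  qed
  have diff: "v (Suc n) - v n = r ^ n * (v 1 - v 0)" for n
    by (induction n) (simp_all add: step)
  \<comment> \<open>By \<open>b = - a * x * (1 + r)\<close> and
    \<open>u 1 * c = a * x * v 1\<close>, the left side is the negative of the expression in the
    sign hypothesis.\<close>
  have "(a * x)\<^sup>2 * (1 + r) * (v 0 * (v 1 - v 0 - r * v 0)) \<ge> 0"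
    using assms(8) by (simp add: v_def b c) (simp add: \<beta> power2_eq_square algebra_simps)
  moreover have "(a * x)\<^sup>2 * (1 + r) > 0"
    using \<open>a \<noteq> 0\<close> \<open>x \<noteq> 0\<close> \<open>0 < r\<close> by simp
  ultimately have sgn: "v 0 * (v 1 - v 0 - r * v 0) \<ge> 0"
    by (simp only: zero_le_mult_iff) linarith
  \<comment> \<open>Take \<open>v 1\<close> if \<open>v 0 = 0\<close>, and \<open>v 0\<close>
    otherwise; in the latter case \<open>sgn\<close> gives
    \<open>v 0 * (v 1 - v 0) \<ge> r * (v 0 * v 0) > 0\<close>.\<close>
  obtain \<sigma> :: real where \<sigma>: "\<sigma> \<noteq> 0" "0 \<le> \<sigma> * v 0" "0 < \<sigma> * (v 1 - v 0)"
  proof (cases "v 0 = 0")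
    case True
    then have "v 1 \<noteq> 0" using assms(2) \<open>\<beta> \<noteq> 0\<close> by (auto simp: v_def)
    then have "0 < v 1 * v 1" by (simp only: zero_less_mult_iff) linarith
    with True that[of "v 1"] \<open>v 1 \<noteq> 0\<close> show ?thesis by simp
  next
    case False
    then have "0 < r * (v 0 * v 0)" using \<open>0 < r\<close> by (simp add: zero_less_mult_iff) linarith
    with False that[of "v 0"] sgn show ?thesis by (simp add: algebra_simps)
  qed
  define w where "w n = \<sigma> * v n" for n
  have "w (Suc n) - w n > 0" for n
  proof -
    have "w (Suc n) - w n = r ^ n * (\<sigma> * (v 1 - v 0))"
      using diff[of n] by (simp add: w_def flip: right_diff_distrib)
    then show ?thesis using \<sigma> \<open>0 < r\<close> by simp
  qed
  then have w: "w n < w (Suc n)" for n by (simp add: algebra_simps)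
  have w0: "w 0 \<ge> 0" using \<sigma> by (simp add: w_def)
  have radius: "\<bar>c\<bar> / norm (of_real a * \<alpha>) = \<bar>\<beta>\<bar>"
    using \<open>a \<noteq> 0\<close> \<open>x \<noteq> 0\<close> by (simp add: \<alpha> c norm_mult abs_mult)
  show ?thesis
  \<comment> \<open>The bound starts at \<open>m = 1\<close> because \<open>w 0\<close> may vanish,
    while strict growth makes \<open>w m\<close> positive from there on.\<close>
  proof (intro eventually_sequentiallyI[of 1] allI impI)
    fix m z assume "1 \<le> m" and z: "poly (partial_sum_poly u m) z = 0"
    have "w 0 < w m" using lift_Suc_mono_less[of w 0 m] w \<open>1 \<le> m\<close> by simp
    \<comment> \<open>Dividing \<open>z\<close> by \<open>\<beta>\<close> cancels the factor
      \<open>\<beta> ^ n\<close> in \<open>w n\<close>, so the unit disc for \<open>w\<close>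
      becomes the disc of radius \<open>\<bar>\<beta>\<bar>\<close> for \<open>u\<close>.\<close>
    have "(\<Sum>n\<le>m. of_real (w n) * (z / of_real \<beta>) ^ n)
        = of_real \<sigma> * (\<Sum>n\<le>m. of_real (u n) * z ^ n)"
      using \<open>\<beta> \<noteq> 0\<close> unfolding sum_distrib_left
      by (intro sum.cong) (simp_all add: w_def v_def field_simps)
    also have "\<dots> = 0"
      using z by (simp add: partial_sum_poly_def poly_sum poly_monom)
    finally have "norm (z / of_real \<beta>) \<le> 1"
      using w w0 \<open>w 0 < w m\<close> by (intro enestrom_kakeya[of m w]) (auto intro: less_imp_le)
    then show "z \<in> cball 0 (\<bar>c\<bar> / norm (complex_of_real a * \<alpha>))"
      using \<open>\<beta> \<noteq> 0\<close> unfolding radius by (simp add: norm_divide)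
  qed
qed

end
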